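(* Let $c>0$ be the wave speed and let $\Omega=\Omega^{(l)}\cup\Omega^{(r)}$ be the two-block domain described in the context, with the operators $H_\Omega$, $D_L$, $P$, $e_{\partial\Omega_i}$, $d_{\partial\Omega_i}$, $H_{\partial\Omega_i}$ defined there. Consider the ODE system for $\mathbf{v}:[0,\infty)\to\mathbb{R}^{\hat N}$, $$\mathbf{v}_{tt}=A\mathbf{v}+B\mathbf{v}_t+\mathbf{F}(t),\quad t>0,\qquad \mathbf{v}=\mathbf{v}_t=0,\quad t=0,$$ where $$A=c^2P\bigl(D_L+SAT_{\partial\Omega_2}+SAT^{(A)}_{\partial\Omega_3}\bigr)P,\qquad B=cP\,SAT^{(B)}_{\partial\Omega_3}P,\qquad \mathbf{F}(t)=P\mathbf{d}_sf(t),$$ $$SAT_{\partial\Omega_2}=-H_\Omega^{-1}e_{\partial\Omega_2}^\top H_{\partial\Omega_2}d_{\partial\Omega_2},\quad SAT^{(A)}_{\partial\Omega_3}=-H_\Omega^{-1}e_{\partial\Omega_3}^\top H_{\partial\Omega_3}d_{\partial\Omega_3},\quad SAT^{(B)}_{\partial\Omega_3}=-H_\Omega^{-1}e_{\partial\Omega_3}^\top H_{\partial\Omega_3}e_{\partial\Omega_3}.$$ This ODE system is stable (in the sense of the energy method, as defined in the context): for every solution $\mathbf{v}$ of the homogeneous system $\mathbf{v}_{tt}=A\mathbf{v}+B\mathbf{v}_t$ with arbitrary initial data, writing $\tilde{\mathbf{v}}=P\mathbf{v}$, $$\frac{d}{dt}\Bigl(\|\mathbf{v}_t\|^2_{H_\Omega}+c^2\|D_x^+E\tilde{\mathbf{v}}\|^2_{H_\Omega^+}+c^2\|D_y^+E\tilde{\mathbf{v}}\|^2_{H_\Omega^+}\Bigr)\le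 0 .$$
   Context: Notation: for a square matrix $M$, $(\mathbf{a},\mathbf{b})_M=\mathbf{a}^\top M\mathbf{b}$ and $\|\mathbf{a}\|_M^2=\mathbf{a}^\top M\mathbf{a}$; for boundary quadratures $\langle\mathbf{a},\mathbf{b}\rangle_M=\mathbf{a}^\top M\mathbf{b}$. Stability (energy method): it is sufficient to consider the homogeneous problem $\mathbf{F}=0$; the system is called stable if the semi-discrete energy $\|\mathbf{v}_t\|^2_{H_\Omega}+c^2\|D_x^+EP\mathbf{v}\|^2_{H_\Omega^+}+c^2\|D_y^+EP\mathbf{v}\|^2_{H_\Omega^+}$ has nonpositive time derivative along every solution of the homogeneous system. One-dimensional operators. Fix $m$ grid points $0=x_1<\dots<x_m=1$ (endpoints included; in the paper Gauss-Lobatto points), a diagonal matrix $H\in\mathbb{R}^{m\times m}$ with positive diagonal (quadrature weights), $e_l=[1,0,\dots,0]^\top$, $e_r=[0,\dots,0,1]^\top\in\mathbb{R}^m$, and a first derivative SBP operator $D_1\in\mathbb{R}^{m\times m}$, $D_1\approx\partial/\partial x$, i.e. $HD_1+D_1^\top H=-e_le_l^\top+e_re_r^\top$. Two-dimensional reference operators on $[0,1]^2$ with coordinates $(\xi,\eta)$ (grid values ordered with $\eta$ running fastest): $D_\xi=D_1\otimes I_m$, $D_\eta=I_m\otimes D_1$, $H_\xi=H\otimes I_m$, $H_\eta=I_m\otimes H$, $e_w=e_l^\top\otimes I_m$, $e_e=e_r^\top\otimes I_m$, $e_s=I_m\otimes e_l^\top$, $e_n=I_m\otimes e_r^\top$.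 For a diagonal matrix $b\in\mathbb{R}^{m^2\times m^2}$, $D_{\xi\xi}^{(b)}=D_\xi bD_\xi$ and $D_{\eta\eta}^{(b)}=D_\eta bD_\eta$ (variable-coefficient second derivatives obtained line by line by applying $D_1$ twice). Single curvilinear block. A block is the image of $[0,1]^2$ under a map $(x(\xi,\eta),y(\xi,\eta))$; $\mathbf{x},\mathbf{y}\in\mathbb{R}^{m^2}$ are the coordinates of its grid points. Set $X_\xi=\mathrm{diag}(D_\xi\mathbf{x})$, $X_\eta=\mathrm{diag}(D_\eta\mathbf{x})$, $Y_\xi=\mathrm{diag}(D_\xi\mathbf{y})$, $Y_\eta=\mathrm{diag}(D_\eta\mathbf{y})$, $J=X_\xi Y_\eta-X_\eta Y_\xi$ (assumed to have positive diagonal), $\alpha_1=J^{-1}(X_\eta^2+Y_\eta^2)$, $\beta=-J^{-1}(X_\xi X_\eta+Y_\xi Y_\eta)$, $\alpha_2=J^{-1}(X_\xi^2+Y_\xi^2)$, $W_1=\sqrt{X_\xi^2+Y_\xi^2}$, $W_2=\sqrt{X_\eta^2+Y_\eta^2}$. The block operators are: - Laplace operator $J^{-1}(D_{\xi\xi}^{(\alpha_1)}+D_\eta\beta D_\xi+D_\xi\beta D_\eta+D_{\eta\eta}^{(\alpha_2)})$; - $D_x=J^{-1}(Y_\eta D_\xi-Y_\xi D_\eta)$, $D_y=J^{-1}(-X_\eta D_\xi+X_\xi D_\eta)$; - inner product matrix $H_\xi H_\eta J$; - boundary quadratures $H_w=He_wW_2e_w^\top$, $H_e=He_eW_2e_e^\top$,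 $H_s=He_sW_1e_s^\top$, $H_n=He_nW_1e_n^\top$; - normal derivatives $d_k=n_k^{(1)}e_kD_x+n_k^{(2)}e_kD_y$, $k\in\{w,e,s,n\}$, where $n_k^{(1)},n_k^{(2)}$ are the $m\times m$ diagonal matrices of the components of the outward unit normal at the boundary points, computed with the discrete metric: $(n_e^{(1)},n_e^{(2)})=(e_eW_2^{-1}Y_\eta e_e^\top,\,-e_eW_2^{-1}X_\eta e_e^\top)$, $(n_w^{(1)},n_w^{(2)})=(-e_wW_2^{-1}Y_\eta e_w^\top,\,e_wW_2^{-1}X_\eta e_w^\top)$, $(n_n^{(1)},n_n^{(2)})=(-e_nW_1^{-1}Y_\xi e_n^\top,\,e_nW_1^{-1}X_\xi e_n^\top)$, $(n_s^{(1)},n_s^{(2)})=(e_sW_1^{-1}Y_\xi e_s^\top,\,-e_sW_1^{-1}X_\xi e_s^\top)$. Two-block domain. Superscripts $(l),(r)$ denote quantities of the left and right block. Both blocks use the same one-dimensional operators on the reference domain. The east side of $\Omega^{(l)}$ and the west side of $\Omega^{(r)}$ form the interface, and grid points there coincide: $e_e^{(l)}\mathbf{x}^{(l)}=e_w^{(r)}\mathbf{x}^{(r)}$, $e_e^{(l)}\mathbf{y}^{(l)}=e_w^{(r)}\mathbf{y}^{(r)}$; no other grid points coincide. Let $H_{\Omega^{(l)}},H_{\Omega^{(r)}}$ be the block inner product matrices, $D_L^{(l)},D_L^{(r)}$ the block Laplace operators, and let $$H_\Omega^+=\begin{bmatrix}H_{\Omega^{(l)}}&0\\0&H_{\Omega^{(r)}}\end{bmatrix},\quad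 D_L^+=\begin{bmatrix}D_L^{(l)}&0\\0&D_L^{(r)}\end{bmatrix},\quad D_x^+=\begin{bmatrix}D_x^{(l)}&0\\0&D_x^{(r)}\end{bmatrix},\quad D_y^+=\begin{bmatrix}D_y^{(l)}&0\\0&D_y^{(r)}\end{bmatrix}.$$ Embedding operator. Let $N=2m^2$, let $\mathbf{S}\in\mathbb{R}^{N\times2}$ be the matrix whose rows are the coordinates of all grid points (left block first, then right block), and let $\hat{\mathbf{S}}\in\mathbb{R}^{\hat N\times2}$ contain each distinct row of $\mathbf{S}$ exactly once ($\hat N$ is the number of distinct grid points). $E\in\mathbb{R}^{N\times\hat N}$ is the 0-1 matrix whose row $i$ has its single nonzero entry, equal to 1, in the column $j$ for which row $j$ of $\hat{\mathbf{S}}$ equals row $i$ of $\mathbf{S}$; thus $\mathbf{S}=E\hat{\mathbf{S}}$. Reduced operators: $$\tilde D_L^+=D_L^+-(H_\Omega^+)^{-1}\begin{bmatrix}e_e^{(l)\top}H_e^{(l)}d_e^{(l)}&e_e^{(l)\top}H_e^{(l)}d_w^{(r)}\\0&0\end{bmatrix},\qquad H_\Omega=E^\top H_\Omega^+E,\qquad D_L=H_\Omega^{-1}E^\top H_\Omega^+\tilde D_L^+E.$$ Physical boundary operators ($\partial\Omega_1$ the two north sides, with Dirichlet condition; $\partial\Omega_2$ the two south sides, with Neumann condition; $\partial\Omega_3$ the west side of the left block and the east side of the right block, with first-order outflow condition $u_t+c\,n\cdot\nabla u=0$), with $\mathrm{diag}(A,B)$ denoting the block diagonal matrix: $e_{\partial\Omega_1}=\mathrm{diag}(e_n^{(l)},e_n^{(r)})E$,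 $d_{\partial\Omega_1}=\mathrm{diag}(d_n^{(l)},d_n^{(r)})E$, $H_{\partial\Omega_1}=\mathrm{diag}(H_n^{(l)},H_n^{(r)})$; $e_{\partial\Omega_2}=\mathrm{diag}(e_s^{(l)},e_s^{(r)})E$, $d_{\partial\Omega_2}=\mathrm{diag}(d_s^{(l)},d_s^{(r)})E$, $H_{\partial\Omega_2}=\mathrm{diag}(H_s^{(l)},H_s^{(r)})$; $e_{\partial\Omega_3}=\mathrm{diag}(e_w^{(l)},e_e^{(r)})E$, $d_{\partial\Omega_3}=\mathrm{diag}(d_w^{(l)},d_e^{(r)})E$, $H_{\partial\Omega_3}=\mathrm{diag}(H_w^{(l)},H_e^{(r)})$. Projection operator: with $L=e_{\partial\Omega_1}$, where the repeated row corresponding to the grid point shared by the two north sides is kept only once (so that $L$ has full row rank), $$P=I_{\hat N}-H_\Omega^{-1}L^\top(LH_\Omega^{-1}L^\top)^{-1}L .$$ Source: $f$ is a given function of time, the source location $(x_s,y_s)$ is a grid point, and $(\mathbf{d}_s)_i=(H_\Omega^{-1})_{i,i}$ if the $i$-th grid point (row $i$ of $\hat{\mathbf{S}}$) equals $(x_s,y_s)$ and $(\mathbf{d}_s)_i=0$ otherwise. *)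

theory Defs
  imports "HOL-Analysis.Analysis"
begin

section \<open>Matrices\<close>

text \<open>
  Matrices are indexed by finite types. A product type \<open>'m \<times> 'm\<close> indexes the tensor grid of one
  block (first component: \<open>\<xi>\<close> index, second component: \<open>\<eta>\<close> index; the lexicographic order is the
  ordering with \<open>\<eta>\<close> running fastest), and a sum type indexes block matrices and stacked vectors.
\<close>

definition diagonal :: "real^'n^'n \<Rightarrow> bool" where
  "diagonal M \<longleftrightarrow> (\<forall>i j. i \<noteq> j \<longrightarrow> M $ i $ j = 0)"

definition diag_of :: "real^'n \<Rightarrow> real^'n^'n" where
  "diag_of a = (\<chi> i j. if i = j then a $ i else 0)"

definition diag_sqrt :: "real^'n^'n \<Rightarrow> real^'n^'n" where
  "diag_sqrt M = diag_of (\<chi> i. sqrt (M $ i $ i))"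

definition kron :: "real^'c^'a \<Rightarrow> real^'d^'b \<Rightarrow> real^('c \<times> 'd)^('a \<times> 'b)" where
  "kron A B = (\<chi> p q. A $ fst p $ fst q * B $ snd p $ snd q)"

text \<open>
  The Kronecker products \<open>a\<^sup>\<top> \<otimes> M\<close> and \<open>M \<otimes> a\<^sup>\<top>\<close> with a row vector; their rows are indexed by the
  rows of \<open>M\<close> alone, since the row vector has a single row.
\<close>

definition kron_row_left :: "real^'c \<Rightarrow> real^'d^'b \<Rightarrow> real^('c \<times> 'd)^'b" where
  "kron_row_left a M = (\<chi> i q. a $ fst q * M $ i $ snd q)"

definition kron_row_right :: "real^'c^'b \<Rightarrow> real^'d \<Rightarrow> real^('c \<times> 'd)^'b" where
  "kron_row_right M a = (\<chi> i q. M $ i $ fst q * a $ snd q)"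

definition block_mat ::
  "real^'c^'a \<Rightarrow> real^'d^'a \<Rightarrow> real^'c^'b \<Rightarrow> real^'d^'b \<Rightarrow> real^('c + 'd)^('a + 'b)" where
  "block_mat A B C D = (\<chi> i j. case i of
      Inl i' \<Rightarrow> (case j of Inl j' \<Rightarrow> A $ i' $ j' | Inr j' \<Rightarrow> B $ i' $ j')
    | Inr i' \<Rightarrow> (case j of Inl j' \<Rightarrow> C $ i' $ j' | Inr j' \<Rightarrow> D $ i' $ j'))"

definition block_diag :: "real^'c^'a \<Rightarrow> real^'d^'b \<Rightarrow> real^('c + 'd)^('a + 'b)" where
  "block_diag A B = block_mat A 0 0 B"

definition sq_norm :: "real^'n^'n \<Rightarrow> real^'n \<Rightarrow> real" where
  "sq_norm M a = a \<bullet> (M *v a)"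

text \<open>\<open>B\<close> contains each distinct row of \<open>A\<close> exactly once (in some order).\<close>

definition distinct_rows_of :: "real^'c^'b \<Rightarrow> real^'c^'a \<Rightarrow> bool" where
  "distinct_rows_of B A \<longleftrightarrow> inj (\<lambda>j. B $ j) \<and> range (\<lambda>j. B $ j) = range (\<lambda>i. A $ i)"


section \<open>One-dimensional operators\<close>

type_synonym 'm op1 = "real^'m^'m"
type_synonym 'm op2 = "real^('m \<times> 'm)^('m \<times> 'm)"
type_synonym 'm trace = "real^('m \<times> 'm)^'m"
type_synonym 'm op4 = "real^(('m \<times> 'm) + ('m \<times> 'm))^(('m \<times> 'm) + ('m \<times> 'm))"

text \<open>
  The \<open>m\<close> grid points are indexed by a finite linearly ordered type; its least and greatest elements
  are the indices \<open>1\<close> and \<open>m\<close>.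
\<close>

definition first_idx :: "'m::{finite,linorder}" where "first_idx = Min UNIV"
definition last_idx :: "'m::{finite,linorder}" where "last_idx = Max UNIV"

definition e_l :: "real^'m::{finite,linorder}" where "e_l = axis first_idx 1"
definition e_r :: "real^'m::{finite,linorder}" where "e_r = axis last_idx 1"

definition outer :: "real^'m \<Rightarrow> real^'n \<Rightarrow> real^'n^'m" where
  "outer a b = (\<chi> i j. a $ i * b $ j)"

definition unit_grid :: "real^'m::{finite,linorder} \<Rightarrow> bool" where
  "unit_grid z \<longleftrightarrow> (\<forall>i j. i < j \<longrightarrow> z $ i < z $ j) \<and> z $ first_idx = 0 \<and> z $ last_idx = 1"

definition sbp_operator :: "('m::{finite,linorder}) op1 \<Rightarrow> 'm op1 \<Rightarrow> bool" where
  "sbp_operator H D \<longleftrightarrow>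
     diagonal H \<and> (\<forall>i. 0 < H $ i $ i) \<and>
     H ** D + transpose D ** H = - outer e_l e_l + outer e_r e_r"


section \<open>Reference operators on the unit square\<close>

definition D_xi :: "('m::finite) op1 \<Rightarrow> 'm op2" where "D_xi D = kron D (mat 1)"
definition D_eta :: "('m::finite) op1 \<Rightarrow> 'm op2" where "D_eta D = kron (mat 1) D"
definition H_xi :: "('m::finite) op1 \<Rightarrow> 'm op2" where "H_xi H = kron H (mat 1)"
definition H_eta :: "('m::finite) op1 \<Rightarrow> 'm op2" where "H_eta H = kron (mat 1) H"

definition e_w :: "('m::{finite,linorder}) trace" where "e_w = kron_row_left e_l (mat 1)"
definition e_e :: "('m::{finite,linorder}) trace" where "e_e = kron_row_left e_r (mat 1)"
definition e_s :: "('m::{finite,linorder}) trace" where "e_s = kron_row_right (mat 1) e_l"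
definition e_n :: "('m::{finite,linorder}) trace" where "e_n = kron_row_right (mat 1) e_r"

definition D_xixi :: "('m::finite) op1 \<Rightarrow> 'm op2 \<Rightarrow> 'm op2" where
  "D_xixi D b = D_xi D ** b ** D_xi D"
definition D_etaeta :: "('m::finite) op1 \<Rightarrow> 'm op2 \<Rightarrow> 'm op2" where
  "D_etaeta D b = D_eta D ** b ** D_eta D"


section \<open>A single curvilinear block\<close>

text \<open>
  A discrete block is the pair \<open>(x, y)\<close> of the coordinate vectors of its grid points. All operators
  of a block depend on its map only through these vectors.
\<close>

type_synonym 'm block = "(real^('m \<times> 'm)) \<times> (real^('m \<times> 'm))"

definition sample_block :: "real^'m \<Rightarrow> (real \<times> real \<Rightarrow> real \<times> real) \<Rightarrow> 'm block" where
  "sample_block z \<phi> =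
     (\<chi> p. fst (\<phi> (z $ fst p, z $ snd p)), \<chi> p. snd (\<phi> (z $ fst p, z $ snd p)))"

definition X_xi :: "('m::finite) op1 \<Rightarrow> 'm block \<Rightarrow> 'm op2" where "X_xi D b = diag_of (D_xi D *v fst b)"
definition X_eta :: "('m::finite) op1 \<Rightarrow> 'm block \<Rightarrow> 'm op2" where "X_eta D b = diag_of (D_eta D *v fst b)"
definition Y_xi :: "('m::finite) op1 \<Rightarrow> 'm block \<Rightarrow> 'm op2" where "Y_xi D b = diag_of (D_xi D *v snd b)"
definition Y_eta :: "('m::finite) op1 \<Rightarrow> 'm block \<Rightarrow> 'm op2" where "Y_eta D b = diag_of (D_eta D *v snd b)"

definition jac :: "('m::finite) op1 \<Rightarrow> 'm block \<Rightarrow> 'm op2" where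
  "jac D b = X_xi D b ** Y_eta D b - X_eta D b ** Y_xi D b"

definition alpha1 :: "('m::finite) op1 \<Rightarrow> 'm block \<Rightarrow> 'm op2" where
  "alpha1 D b = matrix_inv (jac D b) ** (X_eta D b ** X_eta D b + Y_eta D b ** Y_eta D b)"
definition alpha2 :: "('m::finite) op1 \<Rightarrow> 'm block \<Rightarrow> 'm op2" where
  "alpha2 D b = matrix_inv (jac D b) ** (X_xi D b ** X_xi D b + Y_xi D b ** Y_xi D b)"
definition beta12 :: "('m::finite) op1 \<Rightarrow> 'm block \<Rightarrow> 'm op2" where
  "beta12 D b = - (matrix_inv (jac D b) ** (X_xi D b ** X_eta D b + Y_xi D b ** Y_eta D b))"

definition W1 :: "('m::finite) op1 \<Rightarrow> 'm block \<Rightarrow> 'm op2" where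
  "W1 D b = diag_sqrt (X_xi D b ** X_xi D b + Y_xi D b ** Y_xi D b)"
definition W2 :: "('m::finite) op1 \<Rightarrow> 'm block \<Rightarrow> 'm op2" where
  "W2 D b = diag_sqrt (X_eta D b ** X_eta D b + Y_eta D b ** Y_eta D b)"

definition lap :: "('m::finite) op1 \<Rightarrow> 'm block \<Rightarrow> 'm op2" where
  "lap D b = matrix_inv (jac D b) **
     (D_xixi D (alpha1 D b) + D_eta D ** beta12 D b ** D_xi D
      + D_xi D ** beta12 D b ** D_eta D + D_etaeta D (alpha2 D b))"

definition D_x :: "('m::finite) op1 \<Rightarrow> 'm block \<Rightarrow> 'm op2" where
  "D_x D b = matrix_inv (jac D b) ** (Y_eta D b ** D_xi D - Y_xi D b ** D_eta D)"
definition D_y :: "('m::finite) op1 \<Rightarrow> 'm block \<Rightarrow> 'm op2" where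
  "D_y D b = matrix_inv (jac D b) ** (- (X_eta D b ** D_xi D) + X_xi D b ** D_eta D)"

definition H_block :: "('m::finite) op1 \<Rightarrow> 'm op1 \<Rightarrow> 'm block \<Rightarrow> 'm op2" where
  "H_block H D b = H_xi H ** H_eta H ** jac D b"

context
  fixes H D :: "('m::{finite,linorder}) op1"
    and b :: "'m block"
begin

definition H_w :: "'m op1" where "H_w = H ** e_w ** W2 D b ** transpose e_w"
definition H_e :: "'m op1" where "H_e = H ** e_e ** W2 D b ** transpose e_e"
definition H_s :: "'m op1" where "H_s = H ** e_s ** W1 D b ** transpose e_s"
definition H_n :: "'m op1" where "H_n = H ** e_n ** W1 D b ** transpose e_n"

definition n1_e :: "'m op1" where
  "n1_e = e_e ** matrix_inv (W2 D b) ** Y_eta D b ** transpose e_e"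
definition n2_e :: "'m op1" where
  "n2_e = - (e_e ** matrix_inv (W2 D b) ** X_eta D b ** transpose e_e)"
definition n1_w :: "'m op1" where
  "n1_w = - (e_w ** matrix_inv (W2 D b) ** Y_eta D b ** transpose e_w)"
definition n2_w :: "'m op1" where
  "n2_w = e_w ** matrix_inv (W2 D b) ** X_eta D b ** transpose e_w"
definition n1_n :: "'m op1" where
  "n1_n = - (e_n ** matrix_inv (W1 D b) ** Y_xi D b ** transpose e_n)"
definition n2_n :: "'m op1" where
  "n2_n = e_n ** matrix_inv (W1 D b) ** X_xi D b ** transpose e_n"
definition n1_s :: "'m op1" where
  "n1_s = e_s ** matrix_inv (W1 D b) ** Y_xi D b ** transpose e_s"
definition n2_s :: "'m op1" where
  "n2_s = - (e_s ** matrix_inv (W1 D b) ** X_xi D b ** transpose e_s)"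

definition d_w :: "'m trace" where
  "d_w = n1_w ** e_w ** D_x D b + n2_w ** e_w ** D_y D b"
definition d_e :: "'m trace" where
  "d_e = n1_e ** e_e ** D_x D b + n2_e ** e_e ** D_y D b"
definition d_s :: "'m trace" where
  "d_s = n1_s ** e_s ** D_x D b + n2_s ** e_s ** D_y D b"
definition d_n :: "'m trace" where
  "d_n = n1_n ** e_n ** D_x D b + n2_n ** e_n ** D_y D b"

end


section \<open>Two blocks and the embedding\<close>

text \<open>The rows of \<open>S\<close>: coordinates of the grid points, left block first.\<close>

definition grid_coords :: "('m::finite) block \<Rightarrow> 'm block \<Rightarrow> real^2^(('m \<times> 'm) + ('m \<times> 'm))" where
  "grid_coords l r = (\<chi> i. case i of
      Inl p \<Rightarrow> vector [fst l $ p, snd l $ p]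
    | Inr p \<Rightarrow> vector [fst r $ p, snd r $ p])"

definition east_side :: "(real \<times> real \<Rightarrow> real \<times> real) \<Rightarrow> (real \<times> real) set" where
  "east_side \<phi> = \<phi> ` ({1} \<times> {0..1})"
definition west_side :: "(real \<times> real \<Rightarrow> real \<times> real) \<Rightarrow> (real \<times> real) set" where
  "west_side \<phi> = \<phi> ` ({0} \<times> {0..1})"

definition matching_interface ::
  "('m::{finite,linorder}) block \<Rightarrow> 'm block \<Rightarrow> bool" where
  "matching_interface l r \<longleftrightarrow>
     e_e *v fst l = e_w *v fst r \<and> e_e *v snd l = e_w *v snd r"

definition no_other_coincidence ::
  "('m::{finite,linorder}) block \<Rightarrow> 'm block \<Rightarrow> bool" where
  "no_other_coincidence l r \<longleftrightarrow>
     (\<forall>p q. grid_coords l r $ Inl p = grid_coords l r $ Inl q \<longrightarrow> p = q) \<and>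
     (\<forall>p q. grid_coords l r $ Inr p = grid_coords l r $ Inr q \<longrightarrow> p = q) \<and>
     (\<forall>p q. grid_coords l r $ Inl p = grid_coords l r $ Inr q \<longrightarrow>
        (\<exists>j. p = (last_idx, j) \<and> q = (first_idx, j)))"

definition embedding :: "real^'c^'n \<Rightarrow> real^'c^'k \<Rightarrow> real^'k^'n" where
  "embedding S S' = (\<chi> i j. if S' $ j = S $ i then 1 else 0)"

context
  fixes H D :: "('m::{finite,linorder}) op1"
    and l r :: "'m block"
    and S' :: "real^2^'k"
begin

definition E_mat :: "real^'k^(('m \<times> 'm) + ('m \<times> 'm))" where
  "E_mat = embedding (grid_coords l r) S'"

definition H_plus :: "'m op4" where
  "H_plus = block_diag (H_block H D l) (H_block H D r)"
definition lap_plus :: "'m op4" where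
  "lap_plus = block_diag (lap D l) (lap D r)"
definition D_x_plus :: "'m op4" where
  "D_x_plus = block_diag (D_x D l) (D_x D r)"
definition D_y_plus :: "'m op4" where
  "D_y_plus = block_diag (D_y D l) (D_y D r)"

definition lap_tilde :: "'m op4" where
  "lap_tilde = lap_plus - matrix_inv H_plus **
     block_mat (transpose e_e ** H_e H D l ** d_e D l) (transpose e_e ** H_e H D l ** d_w D r)
               0                                       0"

definition H_Omega :: "real^'k^'k" where
  "H_Omega = transpose E_mat ** H_plus ** E_mat"
definition D_L :: "real^'k^'k" where
  "D_L = matrix_inv H_Omega ** transpose E_mat ** H_plus ** lap_tilde ** E_mat"

definition e_bd1 :: "real^'k^('m + 'm)" where "e_bd1 = block_diag e_n e_n ** E_mat"
definition d_bd1 :: "real^'k^('m + 'm)" where "d_bd1 = block_diag (d_n D l) (d_n D r) ** E_mat"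
definition H_bd1 :: "real^('m + 'm)^('m + 'm)" where "H_bd1 = block_diag (H_n H D l) (H_n H D r)"

definition e_bd2 :: "real^'k^('m + 'm)" where "e_bd2 = block_diag e_s e_s ** E_mat"
definition d_bd2 :: "real^'k^('m + 'm)" where "d_bd2 = block_diag (d_s D l) (d_s D r) ** E_mat"
definition H_bd2 :: "real^('m + 'm)^('m + 'm)" where "H_bd2 = block_diag (H_s H D l) (H_s H D r)"

definition e_bd3 :: "real^'k^('m + 'm)" where "e_bd3 = block_diag e_w e_e ** E_mat"
definition d_bd3 :: "real^'k^('m + 'm)" where "d_bd3 = block_diag (d_w D l) (d_e D r) ** E_mat"
definition H_bd3 :: "real^('m + 'm)^('m + 'm)" where "H_bd3 = block_diag (H_w H D l) (H_e H D r)"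

definition SAT2 :: "real^'k^'k" where
  "SAT2 = - (matrix_inv H_Omega ** transpose e_bd2 ** H_bd2 ** d_bd2)"
definition SAT3A :: "real^'k^'k" where
  "SAT3A = - (matrix_inv H_Omega ** transpose e_bd3 ** H_bd3 ** d_bd3)"
definition SAT3B :: "real^'k^'k" where
  "SAT3B = - (matrix_inv H_Omega ** transpose e_bd3 ** H_bd3 ** e_bd3)"

definition delta_s :: "real \<times> real \<Rightarrow> real^'k" where
  "delta_s xs = (\<chi> i. if S' $ i = vector [fst xs, snd xs] then matrix_inv H_Omega $ i $ i else 0)"

definition proj :: "real^'k^'d \<Rightarrow> real^'k^'k" where
  "proj L = mat 1 -
     matrix_inv H_Omega ** transpose L ** matrix_inv (L ** matrix_inv H_Omega ** transpose L) ** L"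

definition A_mat :: "real \<Rightarrow> real^'k^'d \<Rightarrow> real^'k^'k" where
  "A_mat c L = c\<^sup>2 *\<^sub>R (proj L ** (D_L + SAT2 + SAT3A) ** proj L)"
definition B_mat :: "real \<Rightarrow> real^'k^'d \<Rightarrow> real^'k^'k" where
  "B_mat c L = c *\<^sub>R (proj L ** SAT3B ** proj L)"

definition energy :: "real \<Rightarrow> real^'k^'d \<Rightarrow> real^'k \<Rightarrow> real^'k \<Rightarrow> real" where
  "energy c L v vt = sq_norm H_Omega vt
     + c\<^sup>2 * sq_norm H_plus (D_x_plus *v (E_mat *v (proj L *v v)))
     + c\<^sup>2 * sq_norm H_plus (D_y_plus *v (E_mat *v (proj L *v v)))"

end


section \<open>Second-order systems and stability in the sense of the energy method\<close>

text \<open>The initial value problem \<open>v\<^sub>t\<^sub>t = A v + B v\<^sub>t + F(t)\<close> for \<open>t > 0\<close>, with data for \<open>v\<close>, \<open>v\<^sub>t\<close> at \<open>t = 0\<close>.\<close>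

record ('k::finite) ivp =
  stiffness :: "real^'k^'k"
  damping :: "real^'k^'k"
  forcing :: "real \<Rightarrow> real^'k"
  init_pos :: "real^'k"
  init_vel :: "real^'k"

definition solves :: "('k::finite) ivp \<Rightarrow> (real \<Rightarrow> real^'k) \<Rightarrow> (real \<Rightarrow> real^'k) \<Rightarrow> bool" where
  "solves s v vt \<longleftrightarrow>
     continuous_on {0..} v \<and> continuous_on {0..} vt \<and>
     v 0 = init_pos s \<and> vt 0 = init_vel s \<and>
     (\<forall>t>0. (v has_vector_derivative vt t) (at t) \<and>
            (vt has_vector_derivative stiffness s *v v t + damping s *v vt t + forcing s t) (at t))"

text \<open>
  Only the homogeneous system is considered, with arbitrary data. The existence of the time derivative
  of the energy \<open>en v v\<^sub>t\<close> is part of the claim.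
\<close>

definition energy_stable :: "(real^'k \<Rightarrow> real^'k \<Rightarrow> real) \<Rightarrow> ('k::finite) ivp \<Rightarrow> bool" where
  "energy_stable en s \<longleftrightarrow>
     (\<forall>v0 v1 v vt.
        solves (s\<lparr>forcing := \<lambda>_. 0, init_pos := v0, init_vel := v1\<rparr>) v vt \<longrightarrow>
        (\<forall>t>0. \<exists>d\<le>0. ((\<lambda>\<tau>. en (v \<tau>) (vt \<tau>)) has_real_derivative d) (at t)))"

definition wave_ivp ::
  "('m::{finite,linorder}) op1 \<Rightarrow> 'm op1 \<Rightarrow> 'm block \<Rightarrow> 'm block \<Rightarrow> real^2^'k \<Rightarrow>
   real \<Rightarrow> real^'k^'d \<Rightarrow> real \<times> real \<Rightarrow> (real \<Rightarrow> real) \<Rightarrow> ('k::finite) ivp" where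
  "wave_ivp H D l r S' c L xs f =
     \<lparr> stiffness = A_mat H D l r S' c L,
       damping = B_mat H D l r S' c L,
       forcing = (\<lambda>t. f t *\<^sub>R (proj H D l r S' L *v delta_s H D l r S' xs)),
       init_pos = 0,
       init_vel = 0 \<rparr>"

end

theory Submission
  imports Defs
begin

text \<open>
  On one block, the discrete Laplacian is \<open>J\<^sup>-\<^sup>1 (D\<^sub>\<xi> F + D\<^sub>\<eta> G)\<close> for the two contravariant fluxes
  \<open>F\<close>, \<open>G\<close> of the discrete gradient, so summation by parts in each direction gives Green's formula:
  the pointwise identity \<open>D\<^sub>\<xi> a F + D\<^sub>\<eta> a G = J (D\<^sub>x a D\<^sub>x u + D\<^sub>y a D\<^sub>y u)\<close> handles the interior, and the
  fluxes through the sides are the quadrature-weighted normal derivatives. Gluing the blocks, the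
  correction in the reduced Laplacian removes both interface terms, because traces of embedded
  vectors and the interface quadratures agree from both sides. The boundary terms on the Neumann
  and outflow sides cancel against the SATs, and those on the Dirichlet sides vanish on the range
  of \<open>P\<close>. Since \<open>H\<^sub>\<Omega>\<close> is diagonal and \<open>E\<close>, \<open>L\<close> pick out entries, \<open>P\<close> is the diagonal 0-1 matrix
  deleting the Dirichlet points; it therefore commutes with \<open>H\<^sub>\<Omega>\<close>. What remains of the energy rate is the
  nonpositive outflow term.
\<close>

section \<open>Diagonal matrices and row selections\<close>

lemma diag_of_mult_vec [simp]: "(diag_of a *v x) $ i = a $ i * x $ i"
proof -
  have "(diag_of a *v x) $ i = (\<Sum>j\<in>UNIV. if j = i then a $ i * x $ i else 0)"
    by (simp add: diag_of_def matrix_vector_mult_def if_distrib if_distribR cong: if_cong)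
  then show ?thesis by simp
qed

lemma diag_of_nth [simp]: "diag_of a $ i $ i = a $ i"
  by (simp add: diag_of_def)

lemma diag_of_mult: "diag_of a ** diag_of b = diag_of (\<chi> i. a $ i * b $ i)"
  by (subst matrix_eq) (simp add: vec_eq_iff flip: matrix_vector_mul_assoc)

lemma diag_of_add: "diag_of a + diag_of b = diag_of (a + b)"
  by (simp add: diag_of_def vec_eq_iff)

lemma diag_of_diff: "diag_of a - diag_of b = diag_of (a - b)"
  by (simp add: diag_of_def vec_eq_iff)

lemma diag_of_uminus: "- diag_of a = diag_of (- a)"
  by (simp add: diag_of_def vec_eq_iff)

lemma diag_of_one: "diag_of (\<chi> i. 1) = mat 1"
  by (auto simp: diag_of_def mat_def vec_eq_iff)

lemma diagonal_imp_diag_of: "diagonal M \<Longrightarrow> M = diag_of (\<chi> i. M $ i $ i)"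
  by (auto simp: diagonal_def diag_of_def vec_eq_iff)

text \<open>\<open>matrix_inv\<close> is a choice operator, so an inverse must exist before its
  equations apply. For square matrices a left inverse is also a right inverse, so one product
  identifies it.\<close>

lemma matrix_inv_unique_left:
  fixes A B :: "real^'n^'n"
  assumes "B ** A = mat 1"
  shows "matrix_inv A = B"
proof -
  have "A ** B = mat 1" using assms matrix_left_right_inverse by blast
  then have "invertible A" using assms unfolding invertible_def by blast
  then have "A ** matrix_inv A = mat 1"
    unfolding invertible_def matrix_inv_def by (rule someI2_ex) blast
  then have "B ** (A ** matrix_inv A) = B" by simp
  then show ?thesis using assms by (simp add: matrix_mul_assoc)
qed

lemma matrix_inv_diag_of:
  assumes "\<And>i. a $ i \<noteq> 0"
  shows "matrix_inv (diag_of a) = diag_of (\<chi> i. inverse (a $ i))"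
  using assms by (intro matrix_inv_unique_left) (simp add: diag_of_mult flip: diag_of_one)

lemma diag_sqrt_diag_of: "diag_sqrt (diag_of a) = diag_of (\<chi> i. sqrt (a $ i))"
  by (simp add: diag_sqrt_def)

lemma kron_diag_of:
  "kron (diag_of a) (diag_of b) = diag_of (\<chi> p. a $ fst p * b $ snd p)"
  by (auto simp: kron_def diag_of_def vec_eq_iff)

lemma block_diag_diag_of:
  "block_diag (diag_of a) (diag_of b) =
    diag_of (\<chi> i. case i of Inl p \<Rightarrow> a $ p | Inr p \<Rightarrow> b $ p)"
  by (auto simp: block_diag_def block_mat_def diag_of_def vec_eq_iff split: sum.splits)

lemma inner_vector_matrix_mult: "x \<bullet> (y v* A) = (A *v x) \<bullet> (y :: real^_)"
  by (metis dot_lmul_matrix inner_commute)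

text \<open>Side traces, the embedding and the Dirichlet constraint matrix all have exactly one 1
  per row. Encoding them by an index map turns products into compositions and transposes into sums
  over fibres.\<close>

definition row_sel :: "('a \<Rightarrow> 'b) \<Rightarrow> real^'b^'a" where
  "row_sel \<sigma> = (\<chi> i. axis (\<sigma> i) 1)"

lemma row_sel_mult_vec [simp]: "(row_sel \<sigma> *v x) $ i = x $ \<sigma> i"
  by (simp add: row_sel_def matrix_vector_mul_component inner_axis')

lemma row_sel_mult: "row_sel \<sigma> ** row_sel \<tau> = row_sel (\<lambda>i. \<tau> (\<sigma> i))"
  by (subst matrix_eq) (simp add: vec_eq_iff flip: matrix_vector_mul_assoc)

lemma vec_mult_row_sel:
  "(x v* row_sel \<sigma>) $ j = (\<Sum>i | \<sigma> i = j. x $ i)"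
  by (auto simp: vector_matrix_mult_def row_sel_def axis_def if_distrib
      sum.If_cases if_distribR intro!: sum.cong cong: if_cong)

lemma row_sel_diag_row_sel:
  assumes "inj \<sigma>"
  shows "row_sel \<sigma> ** diag_of a ** transpose (row_sel \<sigma>) = diag_of (\<chi> i. a $ \<sigma> i)"
proof -
  have "{k. \<sigma> k = \<sigma> i} = {i}" for i using assms by (auto dest: injD)
  then show ?thesis
    by (subst matrix_eq)
      (simp add: vec_eq_iff vec_mult_row_sel flip: matrix_vector_mul_assoc)
qed

text \<open>This is the shape of \<open>H_Omega\<close>: a point shared by both blocks collects the
  weights of both copies.\<close>

lemma transpose_row_sel_diag_row_sel:
  "transpose (row_sel \<sigma>) ** diag_of a ** row_sel \<sigma> = diag_of (\<chi> j. \<Sum>i | \<sigma> i = j. a $ i)"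
  by (subst matrix_eq)
    (auto simp: vec_eq_iff vec_mult_row_sel sum_distrib_right intro!: sum.cong
      simp flip: matrix_vector_mul_assoc)

lemma block_diag_row_sel:
  "block_diag (row_sel \<sigma>) (row_sel \<tau>) =
    row_sel (\<lambda>i. case i of Inl p \<Rightarrow> Inl (\<sigma> p) | Inr p \<Rightarrow> Inr (\<tau> p))"
  by (auto simp: block_diag_def block_mat_def row_sel_def axis_def vec_eq_iff split: sum.splits)

text \<open>The rows are unit vectors, so removing repetitions amounts to listing the selected
  indices once each, in some order.\<close>

lemma distinct_rows_of_row_sel:
  assumes "distinct_rows_of L (row_sel \<sigma>)"
  obtains \<tau> where "L = row_sel \<tau>" "inj \<tau>" "range \<tau> = range \<sigma>"
proof -
  have inj: "inj (\<lambda>j. L $ j)" and rng: "range (\<lambda>j. L $ j) = range (\<lambda>i. axis (\<sigma> i) 1)"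
    using assms by (auto simp: distinct_rows_of_def row_sel_def)
  from rng have "\<forall>j. \<exists>k\<in>range \<sigma>. L $ j = axis k 1" by (auto simp: set_eq_iff)
  then obtain \<tau> where \<tau>: "\<And>j. \<tau> j \<in> range \<sigma>" "\<And>j. L $ j = axis (\<tau> j) 1" by metis
  show ?thesis
  proof
    show "L = row_sel \<tau>" by (simp add: vec_eq_iff row_sel_def \<tau>)
    show "inj \<tau>" using inj by (auto simp: inj_def \<tau>)
    have "\<sigma> i \<in> range \<tau>" for i
    proof -
      from rng have "axis (\<sigma> i) 1 \<in> range (\<lambda>j. L $ j)" by blast
      then obtain j where "axis (\<sigma> i) (1::real) = axis (\<tau> j) 1" by (auto simp: \<tau>)
      then show ?thesis by (auto simp: axis_eq_axis)
    qed
    then show "range \<tau> = range \<sigma>" using \<tau>(1) by auto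
  qed
qed

section \<open>Stacked vectors and block matrices\<close>

definition upper :: "real^('a::finite + 'b::finite) \<Rightarrow> real^'a" where "upper x = (\<chi> i. x $ Inl i)"
definition lower :: "real^('a::finite + 'b::finite) \<Rightarrow> real^'b" where "lower x = (\<chi> i. x $ Inr i)"

lemma sum_UNIV_Plus:
  "(\<Sum>i\<in>UNIV. f i) = (\<Sum>i\<in>UNIV. f (Inl i)) + (\<Sum>i\<in>UNIV. f (Inr i) :: real)"
  for f :: "'a::finite + 'b::finite \<Rightarrow> real"
  by (simp add: sum.Plus flip: UNIV_Plus_UNIV)

lemma inner_upper_lower: "x \<bullet> y = upper x \<bullet> upper y + lower x \<bullet> lower y"
  by (simp add: inner_vec_def sum_UNIV_Plus upper_def lower_def)

lemma upper_block_mat: "upper (block_mat A B C D *v x) = A *v upper x + B *v lower x"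
  and lower_block_mat: "lower (block_mat A B C D *v x) = C *v upper x + D *v lower x"
  by (simp_all add: vec_eq_iff upper_def lower_def block_mat_def matrix_vector_mult_def sum_UNIV_Plus)

lemma upper_block_diag [simp]: "upper (block_diag A B *v x) = A *v upper x"
  and lower_block_diag [simp]: "lower (block_diag A B *v x) = B *v lower x"
  by (simp_all add: block_diag_def upper_block_mat lower_block_mat)

lemma upper_diff [simp]: "upper (x - y) = upper x - upper y"
  and lower_diff [simp]: "lower (x - y) = lower x - lower y"
  by (simp_all add: vec_eq_iff upper_def lower_def)

lemma matrix_vector_mult_uminus: "(- A) *v x = - (A *v x)" for A :: "real^'n^'m"
  by (simp add: matrix_vector_mult_def vec_eq_iff sum_negf)

section \<open>Summation by parts on one block\<close>

lemma e_w_row_sel: "e_w = row_sel (\<lambda>j. (first_idx, j))"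
  and e_e_row_sel: "e_e = row_sel (\<lambda>j. (last_idx, j))"
  and e_s_row_sel: "e_s = row_sel (\<lambda>i. (i, first_idx))"
  and e_n_row_sel: "e_n = row_sel (\<lambda>i. (i, last_idx))"
  by (auto simp: e_w_def e_e_def e_s_def e_n_def kron_row_left_def kron_row_right_def e_l_def e_r_def
      row_sel_def axis_def mat_def vec_eq_iff)

lemmas e_row_sel = e_w_row_sel e_e_row_sel e_s_row_sel e_n_row_sel

lemma sum_UNIV_Times:
  "(\<Sum>p\<in>UNIV. f p) = (\<Sum>i\<in>UNIV. \<Sum>j\<in>UNIV. f (i, j))"
  for f :: "'a::finite \<times> 'b::finite \<Rightarrow> real"
  by (simp add: sum.cartesian_product flip: UNIV_Times_UNIV)

lemma D_xi_mult_vec: "(D_xi D *v g) $ (i, j) = (D *v (\<chi> k. g $ (k, j))) $ i"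
  by (auto simp: D_xi_def kron_def mat_def matrix_vector_mult_def sum_UNIV_Times if_distrib
      if_distribR cong: if_cong intro!: sum.cong)

lemma D_eta_mult_vec: "(D_eta D *v g) $ (i, j) = (D *v (\<chi> k. g $ (i, k))) $ j"
proof -
  have "(D_eta D *v g) $ (i, j) = (\<Sum>k\<in>UNIV. \<Sum>m\<in>UNIV. if k = i then D $ j $ m * g $ (i, m) else 0)"
    by (auto simp: D_eta_def kron_def mat_def matrix_vector_mult_def sum_UNIV_Times intro!: sum.cong)
  also have "\<dots> = (\<Sum>m\<in>UNIV. D $ j $ m * g $ (i, m))"
    by (subst sum.swap) simp
  finally show ?thesis by (simp add: matrix_vector_mult_def)
qed

text \<open>Pair the SBP matrix identity with \<open>a\<close> on the left and \<open>g\<close> on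
  the right: the transpose moves \<open>D\<close> onto \<open>a\<close>, and the two rank-one
  matrices evaluate the endpoints.\<close>

lemma sbp_inner:
  assumes "sbp_operator (diag_of h) D"
  shows "(\<Sum>i\<in>UNIV. h $ i * (a $ i * (D *v g) $ i + (D *v a) $ i * g $ i)) =
    a $ last_idx * g $ last_idx - a $ first_idx * g $ first_idx"
proof -
  have outer: "x \<bullet> (outer u w *v y) = (x \<bullet> u) * (w \<bullet> y)" for x u w y :: "real^'m::{finite,linorder}"
    by (simp add: outer_def inner_vec_def matrix_vector_mult_def sum_distrib_left sum_distrib_right mult_ac)
      (subst sum.swap, rule refl)
  have "a \<bullet> ((diag_of h ** D + transpose D ** diag_of h) *v g) =
      a \<bullet> ((- outer e_l e_l + outer e_r e_r) *v g)"
    using assms by (simp add: sbp_operator_def)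
  then have "a \<bullet> (diag_of h *v (D *v g)) + (D *v a) \<bullet> (diag_of h *v g) =
      a $ last_idx * g $ last_idx - a $ first_idx * g $ first_idx"
    by (simp add: matrix_vector_mult_add_rdistrib inner_add_right inner_diff_right
        matrix_vector_mult_diff_rdistrib outer
        inner_vector_matrix_mult e_l_def e_r_def inner_axis inner_axis' flip: matrix_vector_mul_assoc)
  then show ?thesis
    by (simp add: inner_vec_def algebra_simps flip: sum.distrib)
qed

text \<open>Apply the one-dimensional identity on each line of constant \<eta>, then sum with the
  weights of the \<eta> direction; the endpoint terms assemble into the east and west
  traces.\<close>

lemma sbp_xi:
  assumes "sbp_operator (diag_of h) D"
  shows "(\<Sum>p\<in>UNIV. h $ fst p * h $ snd p * (a $ p * (D_xi D *v g) $ p + (D_xi D *v a) $ p * g $ p)) =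
    (e_e *v a) \<bullet> (diag_of h *v (e_e *v g)) - (e_w *v a) \<bullet> (diag_of h *v (e_w *v g))"
proof -
  have "(\<Sum>p\<in>UNIV. h $ fst p * h $ snd p * (a $ p * (D_xi D *v g) $ p + (D_xi D *v a) $ p * g $ p)) =
    (\<Sum>j\<in>UNIV. h $ j * (\<Sum>i\<in>UNIV. h $ i * ((\<chi> k. a $ (k, j)) $ i * (D *v (\<chi> k. g $ (k, j))) $ i
       + (D *v (\<chi> k. a $ (k, j))) $ i * (\<chi> k. g $ (k, j)) $ i)))"
    unfolding sum_UNIV_Times by (subst sum.swap) (simp add: D_xi_mult_vec sum_distrib_left mult_ac)
  also have "\<dots> = (\<Sum>j\<in>UNIV. h $ j * (a $ (last_idx, j) * g $ (last_idx, j) - a $ (first_idx, j) * g $ (first_idx, j)))"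
    by (subst sbp_inner[OF assms]) simp
  finally show ?thesis
    by (simp add: e_row_sel inner_vec_def algebra_simps flip: sum_subtractf)
qed

lemma sbp_eta:
  assumes "sbp_operator (diag_of h) D"
  shows "(\<Sum>p\<in>UNIV. h $ fst p * h $ snd p * (a $ p * (D_eta D *v g) $ p + (D_eta D *v a) $ p * g $ p)) =
    (e_n *v a) \<bullet> (diag_of h *v (e_n *v g)) - (e_s *v a) \<bullet> (diag_of h *v (e_s *v g))"
proof -
  have "(\<Sum>p\<in>UNIV. h $ fst p * h $ snd p * (a $ p * (D_eta D *v g) $ p + (D_eta D *v a) $ p * g $ p)) =
    (\<Sum>j\<in>UNIV. h $ j * (\<Sum>i\<in>UNIV. h $ i * ((\<chi> k. a $ (j, k)) $ i * (D *v (\<chi> k. g $ (j, k))) $ i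
       + (D *v (\<chi> k. a $ (j, k))) $ i * (\<chi> k. g $ (j, k)) $ i)))"
    unfolding sum_UNIV_Times by (simp add: D_eta_mult_vec sum_distrib_left mult_ac)
  also have "\<dots> = (\<Sum>j\<in>UNIV. h $ j * (a $ (j, last_idx) * g $ (j, last_idx) - a $ (j, first_idx) * g $ (j, first_idx)))"
    by (subst sbp_inner[OF assms]) simp
  finally show ?thesis
    by (simp add: e_row_sel inner_vec_def algebra_simps flip: sum_subtractf)
qed

section \<open>Green's formula on a curvilinear block\<close>

lemma jac_diag_of:
  "jac D b = diag_of (\<chi> p. (D_xi D *v fst b) $ p * (D_eta D *v snd b) $ p
     - (D_eta D *v fst b) $ p * (D_xi D *v snd b) $ p)"
  by (simp add: jac_def X_xi_def X_eta_def Y_xi_def Y_eta_def diag_of_mult diag_of_diff)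
    (simp add: diag_of_def vec_eq_iff)

lemma matrix_inv_jac:
  assumes "\<forall>p. 0 < jac D b $ p $ p"
  shows "matrix_inv (jac D b) = diag_of (\<chi> p. inverse (jac D b $ p $ p))"
proof -
  have "jac D b = diag_of (\<chi> p. jac D b $ p $ p)" by (simp add: jac_diag_of)
  then show ?thesis using assms by (metis (no_types, lifting) ext matrix_inv_diag_of less_irrefl vec_lambda_beta)
qed

lemma H_block_diag_of:
  "H_block (diag_of h) D b = diag_of (\<chi> p. h $ fst p * h $ snd p * jac D b $ p $ p)"
  by (simp add: H_block_def H_xi_def H_eta_def kron_diag_of diag_of_mult jac_diag_of flip: diag_of_one)

text \<open>Discrete counterpart of J grad(\<xi>) . grad(u); \<open>flux_eta\<close> plays the same
  role for \<eta>.\<close>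

definition flux_xi :: "('m::finite) op1 \<Rightarrow> 'm block \<Rightarrow> real^('m \<times> 'm) \<Rightarrow> real^('m \<times> 'm)" where
  "flux_xi D b u = alpha1 D b *v (D_xi D *v u) + beta12 D b *v (D_eta D *v u)"

definition flux_eta :: "('m::finite) op1 \<Rightarrow> 'm block \<Rightarrow> real^('m \<times> 'm) \<Rightarrow> real^('m \<times> 'm)" where
  "flux_eta D b u = beta12 D b *v (D_xi D *v u) + alpha2 D b *v (D_eta D *v u)"

lemma lap_mult_vec:
  "lap D b *v u = matrix_inv (jac D b) *v (D_xi D *v flux_xi D b u + D_eta D *v flux_eta D b u)"
  by (simp add: lap_def D_xixi_def D_etaeta_def flux_xi_def flux_eta_def matrix_vector_right_distrib
      matrix_vector_mult_add_rdistrib add_ac flip: matrix_vector_mul_assoc)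

section \<open>Arc length factors, boundary quadratures and normal derivatives\<close>

lemma W1_diag_of: "W1 D b = diag_of (\<chi> p. sqrt ((D_xi D *v fst b) $ p ^ 2 + (D_xi D *v snd b) $ p ^ 2))"
  and W2_diag_of: "W2 D b = diag_of (\<chi> p. sqrt ((D_eta D *v fst b) $ p ^ 2 + (D_eta D *v snd b) $ p ^ 2))"
  by (simp_all add: W1_def W2_def X_xi_def X_eta_def Y_xi_def Y_eta_def diag_of_mult diag_of_add
      diag_sqrt_diag_of power2_eq_square)

lemma H_boundary_diag_of:
  fixes h :: "real^'m::{finite,linorder}"
  shows
  "H_w (diag_of h) D b = diag_of (\<chi> j. h $ j * W2 D b $ (first_idx, j) $ (first_idx, j))"
  "H_e (diag_of h) D b = diag_of (\<chi> j. h $ j * W2 D b $ (last_idx, j) $ (last_idx, j))"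
  "H_s (diag_of h) D b = diag_of (\<chi> i. h $ i * W1 D b $ (i, first_idx) $ (i, first_idx))"
  "H_n (diag_of h) D b = diag_of (\<chi> i. h $ i * W1 D b $ (i, last_idx) $ (i, last_idx))"
proof -
  have sel: "diag_of h ** row_sel \<sigma> ** diag_of a ** transpose (row_sel \<sigma>) = diag_of (\<chi> i. h $ i * a $ \<sigma> i)"
    if "inj \<sigma>" for \<sigma> :: "'m \<Rightarrow> 'm \<times> 'm" and a
    using row_sel_diag_row_sel[OF that, of a] by (simp add: diag_of_mult flip: matrix_mul_assoc)
  have inj: "inj (\<lambda>j. (k, j))" "inj (\<lambda>j. (j, k))" for k :: 'm by (auto simp: inj_def)
  show
    "H_w (diag_of h) D b = diag_of (\<chi> j. h $ j * W2 D b $ (first_idx, j) $ (first_idx, j))"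
    "H_e (diag_of h) D b = diag_of (\<chi> j. h $ j * W2 D b $ (last_idx, j) $ (last_idx, j))"
    "H_s (diag_of h) D b = diag_of (\<chi> i. h $ i * W1 D b $ (i, first_idx) $ (i, first_idx))"
    "H_n (diag_of h) D b = diag_of (\<chi> i. h $ i * W1 D b $ (i, last_idx) $ (i, last_idx))"
    by (simp_all add: sel[OF inj(1)] sel[OF inj(2)] H_w_def H_e_def H_s_def H_n_def e_row_sel W1_diag_of W2_diag_of)
qed

context
  fixes D :: "'m::{finite,linorder} op1" and b :: "'m::{finite,linorder} block"
    and h :: "real^'m::{finite,linorder}"
  assumes jac_pos: "\<forall>p. 0 < jac D b $ p $ p"
begin

lemma metric_diag_of:
  "alpha1 D b = diag_of (\<chi> p. ((D_eta D *v fst b) $ p ^ 2 + (D_eta D *v snd b) $ p ^ 2) / jac D b $ p $ p)"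
  "alpha2 D b = diag_of (\<chi> p. ((D_xi D *v fst b) $ p ^ 2 + (D_xi D *v snd b) $ p ^ 2) / jac D b $ p $ p)"
  "beta12 D b = diag_of (\<chi> p. - ((D_xi D *v fst b) $ p * (D_eta D *v fst b) $ p
      + (D_xi D *v snd b) $ p * (D_eta D *v snd b) $ p) / jac D b $ p $ p)"
  by (simp_all add: alpha1_def alpha2_def beta12_def matrix_inv_jac[OF jac_pos] X_xi_def X_eta_def
      Y_xi_def Y_eta_def diag_of_mult diag_of_add diag_of_uminus)
    (simp_all add: diag_of_def vec_eq_iff divide_simps power2_eq_square)

lemma D_x_mult_vec: "(D_x D b *v u) $ p = ((D_eta D *v snd b) $ p * (D_xi D *v u) $ p
      - (D_xi D *v snd b) $ p * (D_eta D *v u) $ p) / jac D b $ p $ p"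
  and D_y_mult_vec: "(D_y D b *v u) $ p = (- (D_eta D *v fst b) $ p * (D_xi D *v u) $ p
      + (D_xi D *v fst b) $ p * (D_eta D *v u) $ p) / jac D b $ p $ p"
  by (simp_all add: D_x_def D_y_def matrix_inv_jac[OF jac_pos] X_xi_def X_eta_def Y_xi_def Y_eta_def
      matrix_vector_mult_diff_rdistrib matrix_vector_mult_add_rdistrib matrix_vector_mult_uminus
      divide_inverse mult_ac flip: matrix_vector_mul_assoc)

lemma flux_xi_nth: "flux_xi D b u $ p =
    (D_eta D *v snd b) $ p * (D_x D b *v u) $ p - (D_eta D *v fst b) $ p * (D_y D b *v u) $ p"
  and flux_eta_nth: "flux_eta D b u $ p =
    (D_xi D *v fst b) $ p * (D_y D b *v u) $ p - (D_xi D *v snd b) $ p * (D_x D b *v u) $ p"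
  by (simp_all add: flux_xi_def flux_eta_def metric_diag_of D_x_mult_vec D_y_mult_vec)
    (simp_all add: divide_inverse algebra_simps power2_eq_square)

text \<open>Insert the expressions of the fluxes through \<open>D_x\<close> and \<open>D_y\<close>
  and group by these two derivatives of \<open>u\<close>: the coefficients are J times the physical
  derivatives of \<open>a\<close>.\<close>

lemma flux_inner:
  "(D_xi D *v a) $ p * flux_xi D b u $ p + (D_eta D *v a) $ p * flux_eta D b u $ p =
    jac D b $ p $ p * ((D_x D b *v a) $ p * (D_x D b *v u) $ p + (D_y D b *v a) $ p * (D_y D b *v u) $ p)"
proof -
  have "jac D b $ p $ p \<noteq> 0" using jac_pos by (metis less_irrefl)
  then have D_xy: "jac D b $ p $ p * (D_x D b *v a) $ p =
      (D_eta D *v snd b) $ p * (D_xi D *v a) $ p - (D_xi D *v snd b) $ p * (D_eta D *v a) $ p"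
    "jac D b $ p $ p * (D_y D b *v a) $ p =
      - (D_eta D *v fst b) $ p * (D_xi D *v a) $ p + (D_xi D *v fst b) $ p * (D_eta D *v a) $ p"
    by (simp_all add: D_x_mult_vec D_y_mult_vec)
  show ?thesis
    unfolding flux_xi_nth flux_eta_nth distrib_left mult.assoc[symmetric] D_xy
    by (simp add: algebra_simps)
qed

text \<open>A vanishing arc length factor would make both metric derivatives in one direction zero,
  and with them the Jacobian.\<close>

lemma W_nonzero: "W1 D b $ p $ p \<noteq> 0" "W2 D b $ p $ p \<noteq> 0"
proof -
  have "jac D b $ p $ p \<noteq> 0" using jac_pos by (metis less_irrefl)
  then show "W1 D b $ p $ p \<noteq> 0" "W2 D b $ p $ p \<noteq> 0"
    by (auto simp: W1_diag_of W2_diag_of jac_diag_of sum_power2_eq_zero_iff)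
qed

lemma matrix_inv_W:
  "matrix_inv (W1 D b) = diag_of (\<chi> p. inverse (W1 D b $ p $ p))"
  "matrix_inv (W2 D b) = diag_of (\<chi> p. inverse (W2 D b $ p $ p))"
  using W_nonzero by (simp_all add: W1_diag_of W2_diag_of matrix_inv_diag_of)

text \<open>On the east side the unit normal is (Y_\<eta>, -X_\<eta>) / W2, and the flux pairs this
  same vector, without the division, with the gradient. The other sides are analogous, with signs
  fixed by the outward direction.\<close>

lemma normal_derivative_nth:
  "(d_e D b *v u) $ j = flux_xi D b u $ (last_idx, j) / W2 D b $ (last_idx, j) $ (last_idx, j)"
  "(d_w D b *v u) $ j = - flux_xi D b u $ (first_idx, j) / W2 D b $ (first_idx, j) $ (first_idx, j)"
  "(d_n D b *v u) $ j = flux_eta D b u $ (j, last_idx) / W1 D b $ (j, last_idx) $ (j, last_idx)"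
  "(d_s D b *v u) $ j = - flux_eta D b u $ (j, first_idx) / W1 D b $ (j, first_idx) $ (j, first_idx)"
proof -
  have sel: "row_sel \<sigma> ** diag_of a ** diag_of c ** transpose (row_sel \<sigma>) = diag_of (\<chi> i. a $ \<sigma> i * c $ \<sigma> i)"
    if "inj \<sigma>" for \<sigma> :: "'m \<Rightarrow> 'm \<times> 'm" and a c
    using row_sel_diag_row_sel[OF that, of "\<chi> p. a $ p * c $ p"]
    by (simp add: diag_of_mult flip: matrix_mul_assoc)
  have inj: "inj (\<lambda>j. (k, j))" "inj (\<lambda>j. (j, k))" for k :: 'm by (auto simp: inj_def)
  note simps = sel[OF inj(1)] sel[OF inj(2)] matrix_vector_mult_add_rdistrib matrix_vector_mult_uminus
    e_row_sel matrix_inv_W X_xi_def X_eta_def Y_xi_def Y_eta_def flux_xi_nth flux_eta_nth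
    divide_inverse
  show
    "(d_e D b *v u) $ j = flux_xi D b u $ (last_idx, j) / W2 D b $ (last_idx, j) $ (last_idx, j)"
    by (simp add: d_e_def n1_e_def n2_e_def simps algebra_simps flip: matrix_vector_mul_assoc)
  show
    "(d_w D b *v u) $ j = - flux_xi D b u $ (first_idx, j) / W2 D b $ (first_idx, j) $ (first_idx, j)"
    by (simp add: d_w_def n1_w_def n2_w_def simps algebra_simps flip: matrix_vector_mul_assoc)
  show
    "(d_n D b *v u) $ j = flux_eta D b u $ (j, last_idx) / W1 D b $ (j, last_idx) $ (j, last_idx)"
    by (simp add: d_n_def n1_n_def n2_n_def simps algebra_simps flip: matrix_vector_mul_assoc)
  show
    "(d_s D b *v u) $ j = - flux_eta D b u $ (j, first_idx) / W1 D b $ (j, first_idx) $ (j, first_idx)"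
    by (simp add: d_s_def n1_s_def n2_s_def simps algebra_simps flip: matrix_vector_mul_assoc)
qed

text \<open>The arc length factor in the quadrature cancels the normalization of the normal, leaving
  the reference weights \<open>h\<close>.\<close>

lemma normal_flux:
  "H_e (diag_of h) D b *v (d_e D b *v u) = diag_of h *v (e_e *v flux_xi D b u)"
  "H_w (diag_of h) D b *v (d_w D b *v u) = - (diag_of h *v (e_w *v flux_xi D b u))"
  "H_n (diag_of h) D b *v (d_n D b *v u) = diag_of h *v (e_n *v flux_eta D b u)"
  "H_s (diag_of h) D b *v (d_s D b *v u) = - (diag_of h *v (e_s *v flux_eta D b u))"
  by (simp_all add: vec_eq_iff H_boundary_diag_of normal_derivative_nth e_row_sel W_nonzero)

lemma green_block:
  assumes "sbp_operator (diag_of h) D"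
  shows "a \<bullet> (H_block (diag_of h) D b *v (lap D b *v u)) =
     (e_e *v a) \<bullet> (H_e (diag_of h) D b *v (d_e D b *v u))
   + (e_w *v a) \<bullet> (H_w (diag_of h) D b *v (d_w D b *v u))
   + (e_n *v a) \<bullet> (H_n (diag_of h) D b *v (d_n D b *v u))
   + (e_s *v a) \<bullet> (H_s (diag_of h) D b *v (d_s D b *v u))
   - (D_x D b *v a) \<bullet> (H_block (diag_of h) D b *v (D_x D b *v u))
   - (D_y D b *v a) \<bullet> (H_block (diag_of h) D b *v (D_y D b *v u))"
proof -
  have "jac D b $ p $ p \<noteq> 0" for p using jac_pos by (metis less_irrefl)
  then have cancel: "jac D b $ p $ p * (inverse (jac D b $ p $ p) * x) = x" for p x by simp
  let ?g = "\<lambda>p. h $ fst p * h $ snd p"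
  let ?X = "flux_xi D b u" and ?Y = "flux_eta D b u"
  have "a \<bullet> (H_block (diag_of h) D b *v (lap D b *v u)) =
      (\<Sum>p\<in>UNIV. ?g p * (a $ p * (D_xi D *v ?X) $ p + a $ p * (D_eta D *v ?Y) $ p))"
    by (simp add: H_block_diag_of lap_mult_vec matrix_inv_jac[OF jac_pos] inner_vec_def cancel algebra_simps)
  \<comment> \<open>Add and subtract the terms with the derivative on \<open>a\<close>: the first
    two sums become boundary terms by summation by parts, the third becomes the gradient product by
    \<open>flux_inner\<close>.\<close>
  also have "\<dots> = (\<Sum>p\<in>UNIV. ?g p * (a $ p * (D_xi D *v ?X) $ p + (D_xi D *v a) $ p * ?X $ p))
      + (\<Sum>p\<in>UNIV. ?g p * (a $ p * (D_eta D *v ?Y) $ p + (D_eta D *v a) $ p * ?Y $ p))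
      - (\<Sum>p\<in>UNIV. ?g p * ((D_xi D *v a) $ p * ?X $ p + (D_eta D *v a) $ p * ?Y $ p))"
    unfolding sum.distrib[symmetric] sum_subtractf[symmetric]
    by (rule sum.cong) (auto simp: algebra_simps)
  also have "(\<Sum>p\<in>UNIV. ?g p * ((D_xi D *v a) $ p * ?X $ p + (D_eta D *v a) $ p * ?Y $ p)) =
      (D_x D b *v a) \<bullet> (H_block (diag_of h) D b *v (D_x D b *v u))
      + (D_y D b *v a) \<bullet> (H_block (diag_of h) D b *v (D_y D b *v u))"
    unfolding flux_inner
    by (simp add: H_block_diag_of inner_vec_def algebra_simps flip: sum.distrib)
  finally show ?thesis
    unfolding sbp_xi[OF assms] sbp_eta[OF assms] normal_flux by simp
qed

end

section \<open>The two-block system\<close>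

text \<open>Equal row sets give every grid point a matching column, and distinctness makes it
  unique. Surjectivity says that every column is used.\<close>

lemma embedding_row_sel:
  assumes "distinct_rows_of S' S"
  obtains \<sigma> where "embedding S S' = row_sel \<sigma>" "surj \<sigma>" "\<And>i. S' $ \<sigma> i = S $ i"
proof -
  have inj: "inj (\<lambda>j. S' $ j)" and rng: "range (\<lambda>j. S' $ j) = range (\<lambda>i. S $ i)"
    using assms by (auto simp: distinct_rows_of_def)
  from rng have "\<forall>i. \<exists>j. S' $ j = S $ i" by (metis rangeE rangeI)
  then obtain \<sigma> where \<sigma>: "\<And>i. S' $ \<sigma> i = S $ i" by metis
  have eq: "S' $ j = S $ i \<longleftrightarrow> j = \<sigma> i" for i j
    using inj \<sigma> by (auto simp: inj_def)
  show ?thesis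
  proof
    show "embedding S S' = row_sel \<sigma>"
      by (simp add: embedding_def row_sel_def axis_def eq)
    have "\<exists>i. j = \<sigma> i" for j using rng by (metis rangeE rangeI eq)
    then show "surj \<sigma>" by (auto simp: surj_def)
  qed (rule \<sigma>)
qed

text \<open>\<open>W2\<close> involves only \<eta> derivatives, which on the interface line depend
  on the coordinates of that line alone; these agree from both sides.\<close>

lemma H_e_eq_H_w_interface:
  fixes h :: "real^'m::{finite,linorder}"
  assumes "matching_interface l r"
  shows "H_e (diag_of h) D l = H_w (diag_of h) D r"
proof -
  have "fst l $ (last_idx, j) = fst r $ (first_idx, j)" "snd l $ (last_idx, j) = snd r $ (first_idx, j)"
    for j :: 'm
    using assms by (simp_all add: matching_interface_def e_row_sel vec_eq_iff)
  then show ?thesis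
    by (simp add: H_boundary_diag_of W2_diag_of D_eta_mult_vec)
qed

context
  fixes D :: "'m::{finite,linorder} op1" and l r :: "'m::{finite,linorder} block"
    and h :: "real^'m::{finite,linorder}" and S' :: "real^2^'k::finite"
  assumes sbp: "sbp_operator (diag_of h) D"
    and jac_l: "\<forall>p. 0 < jac D l $ p $ p" and jac_r: "\<forall>p. 0 < jac D r $ p $ p"
    and interface: "matching_interface l r"
    and rows_S': "distinct_rows_of S' (grid_coords l r)"
begin

lemma h_pos: "0 < h $ i"
  using sbp by (simp add: sbp_operator_def)

lemma H_plus_diag_of:
  obtains g where "H_plus (diag_of h) D l r = diag_of g" "\<And>i. 0 < g $ i"
proof
  let ?g = "\<chi> i. case i of Inl p \<Rightarrow> h $ fst p * h $ snd p * jac D l $ p $ p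
      | Inr p \<Rightarrow> h $ fst p * h $ snd p * jac D r $ p $ p"
  show "0 < ?g $ i" for i using h_pos jac_l jac_r by (auto split: sum.split)
  show "H_plus (diag_of h) D l r = diag_of ?g"
    by (simp add: H_plus_def H_block_diag_of block_diag_diag_of cong: sum.case_cong)
qed

lemma H_Omega_diag_of:
  obtains \<omega> where "H_Omega (diag_of h) D l r S' = diag_of \<omega>" "\<And>j. 0 < \<omega> $ j"
proof -
  obtain \<sigma> where \<sigma>: "E_mat l r S' = row_sel \<sigma>" "surj \<sigma>"
    using embedding_row_sel[OF rows_S'] unfolding E_mat_def by metis
  obtain g where g: "H_plus (diag_of h) D l r = diag_of g" "\<And>i. 0 < g $ i"
    using H_plus_diag_of by blast
  have "H_Omega (diag_of h) D l r S' = diag_of (\<chi> j. \<Sum>i | \<sigma> i = j. g $ i)"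
    by (simp add: H_Omega_def \<sigma>(1) g(1) transpose_row_sel_diag_row_sel)
  \<comment> \<open>Surjectivity of the embedding map makes each fibre nonempty.\<close>
  moreover have "0 < (\<Sum>i | \<sigma> i = j. g $ i)" for j
    using g(2) \<sigma>(2) by (intro sum_pos) (auto simp: surj_def, metis)
  ultimately show ?thesis using that by simp
qed

text \<open>The two copies of an interface point have equal coordinates, hence select the same entry
  of \<open>w\<close>, since the rows of \<open>S'\<close> are distinct.\<close>

lemma interface_trace: "e_e *v upper (E_mat l r S' *v w) = e_w *v lower (E_mat l r S' *v w)"
proof -
  obtain \<sigma> where \<sigma>: "E_mat l r S' = row_sel \<sigma>" "\<And>i. S' $ \<sigma> i = grid_coords l r $ i"
    using embedding_row_sel[OF rows_S'] unfolding E_mat_def by metis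
  have inj: "inj (\<lambda>j. S' $ j)" using rows_S' by (simp add: distinct_rows_of_def)
  have "grid_coords l r $ Inl (last_idx, j) = grid_coords l r $ Inr (first_idx, j)" for j
    using interface by (simp add: matching_interface_def e_row_sel vec_eq_iff grid_coords_def)
  then have "\<sigma> (Inl (last_idx, j)) = \<sigma> (Inr (first_idx, j))" for j
    using inj by (simp add: inj_def flip: \<sigma>(2))
  then show ?thesis
    by (simp add: \<sigma>(1) e_row_sel vec_eq_iff upper_def lower_def)
qed

text \<open>Adding the two block formulas leaves the interface terms with \<open>d_e\<close> from
  the left and \<open>d_w\<close> from the right. The correction, tested against the left trace with
  the left quadrature, subtracts exactly their sum; the remaining sides regroup by boundary
  condition.\<close>

lemma green_two_block:
  defines "E \<equiv> E_mat l r S'"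
  shows "(E *v w) \<bullet> (H_plus (diag_of h) D l r *v (lap_tilde (diag_of h) D l r *v (E *v u))) =
     (e_bd1 l r S' *v w) \<bullet> (H_bd1 (diag_of h) D l r *v (d_bd1 D l r S' *v u))
   + (e_bd2 l r S' *v w) \<bullet> (H_bd2 (diag_of h) D l r *v (d_bd2 D l r S' *v u))
   + (e_bd3 l r S' *v w) \<bullet> (H_bd3 (diag_of h) D l r *v (d_bd3 D l r S' *v u))
   - (D_x_plus D l r *v (E *v w)) \<bullet> (H_plus (diag_of h) D l r *v (D_x_plus D l r *v (E *v u)))
   - (D_y_plus D l r *v (E *v w)) \<bullet> (H_plus (diag_of h) D l r *v (D_y_plus D l r *v (E *v u)))"
proof -
  obtain g where g: "H_plus (diag_of h) D l r = diag_of g" "\<And>i. 0 < g $ i"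
    using H_plus_diag_of by blast
  have inv: "H_plus (diag_of h) D l r *v (matrix_inv (H_plus (diag_of h) D l r) *v x) = x" for x
    using g(2) by (simp add: g(1) matrix_inv_diag_of less_imp_neq[symmetric] vec_eq_iff)
  have "H_plus (diag_of h) D l r *v (lap_tilde (diag_of h) D l r *v (E *v u)) =
      H_plus (diag_of h) D l r *v (lap_plus D l r *v (E *v u)) -
      block_mat (transpose e_e ** H_e (diag_of h) D l ** d_e D l)
        (transpose e_e ** H_e (diag_of h) D l ** d_w D r) 0 0 *v (E *v u)"
    by (simp add: lap_tilde_def matrix_vector_mult_diff_rdistrib matrix_vector_mult_diff_distrib inv
        flip: matrix_vector_mul_assoc)
  then show ?thesis
    using interface_trace[of w]
    by (simp add: inner_upper_lower[where 'a = "'m \<times> 'm"] inner_upper_lower[where 'a = 'm]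
        H_plus_def lap_plus_def upper_block_mat lower_block_mat
        green_block[OF jac_l sbp] green_block[OF jac_r sbp] inner_diff_right inner_add_right
        H_bd1_def H_bd2_def H_bd3_def e_bd1_def e_bd2_def e_bd3_def d_bd1_def d_bd2_def d_bd3_def
        D_x_plus_def D_y_plus_def H_e_eq_H_w_interface[OF interface] inner_vector_matrix_mult
        flip: matrix_vector_mul_assoc E_def)
qed

lemma H_bd3_nonneg: "0 \<le> x \<bullet> (H_bd3 (diag_of h) D l r *v x)"
proof -
  have "0 \<le> y \<bullet> (diag_of a *v y)" if "\<And>i. 0 \<le> a $ i" for y a :: "real^'m::{finite,linorder}"
    using that by (auto simp: inner_vec_def mult.left_commute[of "y $ _"] intro!: sum_nonneg)
  then show ?thesis
    by (simp add: H_bd3_def inner_upper_lower H_boundary_diag_of W2_diag_of less_imp_le[OF h_pos])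
qed

lemma H_Omega_inv: "H_Omega (diag_of h) D l r S' *v (matrix_inv (H_Omega (diag_of h) D l r S') *v x) = x"
proof -
  obtain \<omega> where \<omega>: "H_Omega (diag_of h) D l r S' = diag_of \<omega>" "\<And>j. 0 < \<omega> $ j"
    using H_Omega_diag_of by blast
  then show ?thesis unfolding \<omega>(1) by (simp add: matrix_inv_diag_of less_imp_neq[symmetric] vec_eq_iff)
qed

text \<open>\<open>H_Omega\<close> cancels its inverse in \<open>D_L\<close> and in the SATs, which
  are the negatives of the Neumann and outflow terms of Green's formula. The hypothesis on
  \<open>w\<close> removes the Dirichlet term.\<close>

lemma energy_identity:
  defines "E \<equiv> E_mat l r S'" and "H \<equiv> H_plus (diag_of h) D l r"
  assumes "e_bd1 l r S' *v w = 0"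
  shows "w \<bullet> (H_Omega (diag_of h) D l r S' *v
      ((D_L (diag_of h) D l r S' + SAT2 (diag_of h) D l r S' + SAT3A (diag_of h) D l r S') *v u)) =
    - ((D_x_plus D l r *v (E *v w)) \<bullet> (H *v (D_x_plus D l r *v (E *v u))))
    - (D_y_plus D l r *v (E *v w)) \<bullet> (H *v (D_y_plus D l r *v (E *v u)))"
  using green_two_block[of w u] assms(3)
  by (simp add: D_L_def SAT2_def SAT3A_def matrix_vector_mult_add_rdistrib matrix_vector_right_distrib
      matrix_vector_mult_uminus linear_neg[OF matrix_vector_mul_linear]
      matrix_vector_mult_diff_rdistrib matrix_vector_mult_diff_distrib
      inner_diff_right inner_add_right H_Omega_inv inner_vector_matrix_mult
      flip: matrix_vector_mul_assoc E_def H_def)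

lemma proj_diag_of:
  assumes "distinct_rows_of L (e_bd1 l r S')"
  obtains p where "proj (diag_of h) D l r S' L = diag_of p"
    "\<And>v. e_bd1 l r S' *v (diag_of p *v v) = 0"
proof -
  obtain \<sigma> where "E_mat l r S' = row_sel \<sigma>"
    using embedding_row_sel[OF rows_S'] unfolding E_mat_def by metis
  then obtain \<rho> where \<rho>: "e_bd1 l r S' = row_sel \<rho>"
    by (simp add: e_bd1_def e_n_row_sel block_diag_row_sel row_sel_mult)
  obtain \<tau> where \<tau>: "L = row_sel \<tau>" "inj \<tau>" "range \<tau> = range \<rho>"
    using assms unfolding \<rho> by (rule distinct_rows_of_row_sel)
  obtain \<omega> where \<omega>: "H_Omega (diag_of h) D l r S' = diag_of \<omega>" "\<And>j. 0 < \<omega> $ j"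
    using H_Omega_diag_of by blast
  have nz: "\<omega> $ j \<noteq> 0" for j using \<omega>(2) by (metis less_irrefl)
  have "proj (diag_of h) D l r S' L *v v = diag_of (\<chi> j. if j \<in> range \<tau> then 0 else 1) *v v" for v
  proof -
    \<comment> \<open>The left side is entry \<open>j\<close> of the subtracted term in
      \<open>proj\<close> before the outer factor \<open>matrix_inv H_Omega\<close>, because the
      inner inverse is diagonal with entries \<open>\<omega> $ \<tau> i\<close>.\<close>
    have "(\<Sum>i | \<tau> i = j. \<omega> $ \<tau> i * v $ \<tau> i) = (if j \<in> range \<tau> then \<omega> $ j * v $ j else 0)" for j
    proof (cases "j \<in> range \<tau>")
      case True
      then obtain i where "j = \<tau> i" by blast
      then have "{i. \<tau> i = j} = {i}" using \<tau>(2) by (auto dest: injD)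
      then show ?thesis using \<open>j = \<tau> i\<close> by simp
    next
      case False
      then have "{i. \<tau> i = j} = {}" by auto
      then show ?thesis using False by simp
    qed
    then show ?thesis
      using nz by (simp add: proj_def \<tau>(1) \<omega>(1) matrix_inv_diag_of row_sel_diag_row_sel[OF \<tau>(2)]
          vec_eq_iff matrix_vector_mult_diff_rdistrib vec_mult_row_sel flip: matrix_vector_mul_assoc)
  qed
  then have "proj (diag_of h) D l r S' L = diag_of (\<chi> j. if j \<in> range \<tau> then 0 else 1)"
    by (simp add: matrix_eq)
  then show ?thesis
    by (rule that) (use \<tau>(3) in \<open>auto simp: \<rho> vec_eq_iff\<close>)
qed

end

section \<open>Time derivative of the energy\<close>

lemma has_vector_derivative_matrix_vector_mult:
  "(f has_vector_derivative f') F \<Longrightarrow> ((\<lambda>t. A *v f t) has_vector_derivative A *v f') F"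
  for A :: "real^'n^'m"
  by (rule bounded_linear.has_vector_derivative[OF matrix_vector_mul_bounded_linear])

text \<open>A diagonal weight is symmetric, so both terms of the product rule coincide.\<close>

lemma sq_norm_diag_of_has_derivative:
  assumes "(f has_vector_derivative f') (at t)"
  shows "((\<lambda>t. sq_norm (diag_of a) (f t)) has_real_derivative 2 * (f' \<bullet> (diag_of a *v f t))) (at t)"
proof -
  have "((\<lambda>t. f t \<bullet> (diag_of a *v f t)) has_vector_derivative
      f t \<bullet> (diag_of a *v f') + f' \<bullet> (diag_of a *v f t)) (at t)"
    by (intro bounded_bilinear.has_vector_derivative[OF bounded_bilinear_inner] assms
        has_vector_derivative_matrix_vector_mult)
  moreover have "f t \<bullet> (diag_of a *v f') = f' \<bullet> (diag_of a *v f t)"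
    by (simp add: inner_vec_def mult_ac)
  ultimately show ?thesis
    by (simp add: sq_norm_def has_real_derivative_iff_has_vector_derivative)
qed

theorem lemma4p1:
  fixes z :: "real^'m::{finite,linorder}"
    and H D :: "'m op1"
    and \<phi>l \<phi>r :: "real \<times> real \<Rightarrow> real \<times> real"
    and l r :: "'m block"
    and S' :: "real^2^'k::finite"
    and L :: "real^'k^'d::finite"
    and c :: real and xs :: "real \<times> real" and f :: "real \<Rightarrow> real"
  assumes "0 < c"
    and "unit_grid z"
    and "sbp_operator H D"
    and "l = sample_block z \<phi>l" and "r = sample_block z \<phi>r"
    and "\<forall>p. 0 < jac D l $ p $ p" and "\<forall>p. 0 < jac D r $ p $ p"
    and "east_side \<phi>l = west_side \<phi>r"
    and "matching_interface l r"
    and "no_other_coincidence l r"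
    and "distinct_rows_of S' (grid_coords l r)"
    and "distinct_rows_of L (e_bd1 l r S')"
    and "\<exists>i. S' $ i = vector [fst xs, snd xs]"
  shows "energy_stable (energy H D l r S' c L) (wave_ivp H D l r S' c L xs f)"
proof -
  obtain h where H: "H = diag_of h"
    using assms(3) diagonal_imp_diag_of unfolding sbp_operator_def by blast
  note ctx = assms(3)[unfolded H] assms(6,7,9,11)
  let ?H\<Omega> = "H_Omega H D l r S'" and ?H = "H_plus H D l r" and ?E = "E_mat l r S'"
  let ?Dx = "D_x_plus D l r" and ?Dy = "D_y_plus D l r"
  obtain g where g: "?H = diag_of g" using H_plus_diag_of[OF ctx] unfolding H by metis
  obtain \<omega> where \<omega>: "?H\<Omega> = diag_of \<omega>"
    using H_Omega_diag_of[OF ctx] unfolding H by metis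
  obtain p where p: "proj H D l r S' L = diag_of p" "\<And>v. e_bd1 l r S' *v (diag_of p *v v) = 0"
    using proj_diag_of[OF ctx assms(12)] unfolding H by metis
  show ?thesis
    unfolding energy_stable_def
  proof (intro allI impI)
    fix v0 v1 v vt t
    assume sol: "solves (wave_ivp H D l r S' c L xs f
        \<lparr>forcing := \<lambda>_. 0, init_pos := v0, init_vel := v1\<rparr>) v vt" and "0 < (t::real)"
    \<comment> \<open>\<open>u\<close> is the projected displacement and \<open>w\<close> its time
      derivative; \<open>a\<close> and \<open>b\<close> are the elastic and damping forces before
      the outer projection and the powers of \<open>c\<close>.\<close>
    define u where "u = diag_of p *v v t"
    define w where "w = diag_of p *v vt t"
    define a where "a = (D_L H D l r S' + SAT2 H D l r S' + SAT3A H D l r S') *v u"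
    define b where "b = SAT3B H D l r S' *v w"
    let ?vtt = "c\<^sup>2 *\<^sub>R (diag_of p *v a) + c *\<^sub>R (diag_of p *v b)"
    have v: "(v has_vector_derivative vt t) (at t)"
      and "(vt has_vector_derivative A_mat H D l r S' c L *v v t + B_mat H D l r S' c L *v vt t) (at t)"
      using sol \<open>0 < t\<close> by (auto simp: solves_def wave_ivp_def)
    then have vt: "(vt has_vector_derivative ?vtt) (at t)"
      by (simp add: A_mat_def B_mat_def p a_def b_def u_def w_def scaleR_matrix_vector_assoc[symmetric]
          flip: matrix_vector_mul_assoc)
    let ?d = "2 * (?vtt \<bullet> (?H\<Omega> *v vt t)) + c\<^sup>2 * (2 * ((?Dx *v (?E *v w)) \<bullet> (?H *v (?Dx *v (?E *v u)))))
       + c\<^sup>2 * (2 * ((?Dy *v (?E *v w)) \<bullet> (?H *v (?Dy *v (?E *v u)))))"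
    have deriv: "((\<lambda>\<tau>. energy H D l r S' c L (v \<tau>) (vt \<tau>)) has_real_derivative ?d) (at t)"
      unfolding energy_def g \<omega> p u_def w_def
      by (intro DERIV_add DERIV_cmult sq_norm_diag_of_has_derivative
          has_vector_derivative_matrix_vector_mult v vt)
    \<comment> \<open>Both matrices are diagonal, so the outer projection moves onto the velocity.
      The test vector becomes \<open>w\<close>, which vanishes at the Dirichlet points as
      \<open>energy_identity\<close> demands.\<close>
    have P_sym: "(diag_of p *v x) \<bullet> (?H\<Omega> *v vt t) = w \<bullet> (?H\<Omega> *v x)" for x
      by (simp add: \<omega> w_def inner_vec_def mult_ac)
    have "?vtt \<bullet> (?H\<Omega> *v vt t) = c\<^sup>2 * (w \<bullet> (?H\<Omega> *v a)) + c * (w \<bullet> (?H\<Omega> *v b))"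
      by (simp add: inner_add_left P_sym)
    moreover have "w \<bullet> (?H\<Omega> *v a) = - ((?Dx *v (?E *v w)) \<bullet> (?H *v (?Dx *v (?E *v u))))
        - (?Dy *v (?E *v w)) \<bullet> (?H *v (?Dy *v (?E *v u)))"
      unfolding a_def H by (rule energy_identity[OF ctx]) (simp add: w_def p)
    \<comment> \<open>The rate of the gradient energy cancels the work of the elastic force, leaving
      only damping.\<close>
    ultimately have "?d = 2 * c * (w \<bullet> (?H\<Omega> *v b))"
      by (simp add: algebra_simps)
    moreover have "w \<bullet> (?H\<Omega> *v b) = - ((e_bd3 l r S' *v w) \<bullet> (H_bd3 H D l r *v (e_bd3 l r S' *v w)))"
      using H_Omega_inv[OF ctx]
      by (simp add: b_def H SAT3B_def matrix_vector_mult_uminus linear_neg[OF matrix_vector_mul_linear]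
          inner_vector_matrix_mult flip: matrix_vector_mul_assoc)
    moreover have "0 \<le> (e_bd3 l r S' *v w) \<bullet> (H_bd3 H D l r *v (e_bd3 l r S' *v w))"
      unfolding H by (rule H_bd3_nonneg[OF ctx])
    ultimately have "?d \<le> 0" using \<open>0 < c\<close> by (simp add: mult_nonneg_nonneg)
    with deriv show "\<exists>d\<le>0. ((\<lambda>\<tau>. energy H D l r S' c L (v \<tau>) (vt \<tau>)) has_real_derivative d) (at t)"
      by blast
  qed
qed

end
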